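(* Let $r\ge 1$ and $k\ge 2$ be integers, let $\mathbf a=(a_1,\dots,a_r)$ be a sequence of positive integers, and let $p_{k,\mathbf a}$ be the restricted $k$-multipartition function. If $m>1$ is an integer, then $$\lim_{N\to\infty}\frac{\#\{n\le N : p_{k,\mathbf a}(n)\not\equiv 0\ (\mathrm{mod}\ m)\}}{N}\ \ge\ \frac{1}{k\sum_{i=1}^r a_i}$$ (where $n$ ranges over nonnegative integers, and the limit is asserted to exist).
   Context: For integers $n\ge 0$, $p_{k,\mathbf a}(n)$ is the number of $k$-tuples $(x^1,\dots,x^k)$ of vectors $x^j=(x^j_1,\dots,x^j_r)\in\mathbb N^r$ (with $0\in\mathbb N$) such that $\sum_{j=1}^k\sum_{i=1}^r a_i x^j_i=n$. Equivalently, $\sum_{n\ge 0}p_{k,\mathbf a}(n)z^n=\prod_{i=1}^r(1-z^{a_i})^{-k}$ for $|z|<1$. *)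

theory Defs
  imports Complex_Main "HOL-Library.FuncSet" "HOL-Number_Theory.Cong"
begin

(* The j-th vector of a k-tuple x is x j, with components x j i; extensional functions on {1..k}
   and {1..r} make tuples and vectors unique.  For positive a 1, ..., a r the set is finite, so
   card is the true number of elements. *)
definition multipartition_count :: "nat \<Rightarrow> nat \<Rightarrow> (nat \<Rightarrow> nat) \<Rightarrow> nat \<Rightarrow> nat" where
  "multipartition_count k r a n =
     card {x \<in> {1..k} \<rightarrow>\<^sub>E ({1..r} \<rightarrow>\<^sub>E (UNIV :: nat set)).
             (\<Sum>j = 1..k. \<Sum>i = 1..r. a i * x j i) = n}"

end

theory Submission
  imports Defs "HOL-Computational_Algebra.Polynomial_FPS"
begin

text \<open>
  The generating function \<open>\<Sum>n. p(n) z^n\<close> is the reciprocal of the polynomial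
  \<open>Q = \<Prod>i. (1 - z ^ a i) ^ k\<close> of degree \<open>D = k * (\<Sum>i. a i)\<close>, so \<open>p\<close> satisfies a linear
  recurrence of order \<open>D\<close> over the integers. What makes the argument work is that both the
  constant and the leading coefficient of \<open>Q\<close> are units: modulo \<open>m\<close> the recurrence can be run
  forwards and backwards, and any solution vanishing at \<open>D\<close> consecutive places vanishes
  everywhere (lemma \<open>zero_window_imp_zero\<close>). This is used twice.

  Applied to \<open>p\<close> itself, it shows that among any \<open>D\<close> consecutive values of \<open>p\<close> one is nonzero
  modulo \<open>m\<close>, because \<open>p(0) = 1\<close>. Applied to the differences \<open>p(n + T) - p(n)\<close>, where \<open>T\<close> is the
  distance between two equal windows of residues provided by the pigeonhole principle, it shows
  that \<open>p\<close> modulo \<open>m\<close> is purely periodic (lemma \<open>linear_recurrence_periodic\<close>). A periodic set of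
  naturals has a density, and one that meets every window of length \<open>D\<close> has density at least
  \<open>1 / D\<close> (lemma \<open>periodic_density\<close>).
\<close>

section \<open>Linear recurrences that can be reversed modulo m\<close>

text \<open>
  The recurrence determines the value just before a window from the window because \<open>c 0\<close> is a unit,
  so a zero window can be moved down to \<open>0\<close>; it determines the value just after the window because
  \<open>c D\<close> is a unit, so the zeros then spread upwards.
\<close>

lemma zero_window_imp_zero:
  fixes c u :: "nat \<Rightarrow> int" and m :: int
  assumes rec: "\<And>n. m dvd (\<Sum>i\<le>D. c i * u (n + i))"
    and units: "c 0 dvd 1" "c D dvd 1"
    and window: "\<And>i. i < D \<Longrightarrow> m dvd u (s + i)"
  shows "m dvd u n"
proof -
  have cancel: "m dvd x" if "e dvd 1" "m dvd e * x" for e x :: int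
    using that by (simp add: dvd_mult_unit_iff')
  have base: "\<And>i. i < D \<Longrightarrow> m dvd u i"
    using window
  proof (induction s)
    case (Suc s)
    have "m dvd u s" if "D > 0"
    proof -
      have "(\<Sum>i\<le>D. c i * u (s + i)) = c 0 * u s + (\<Sum>i<D. c (Suc i) * u (Suc s + i))"
        using sum.atMost_shift[of "\<lambda>i. c i * u (s + i)" D] by simp
      moreover have "m dvd (\<Sum>i<D. c (Suc i) * u (Suc s + i))"
        using Suc.prems(2) by (intro dvd_sum dvd_mult) auto
      ultimately have "m dvd c 0 * u s"
        using rec[of s] by (simp add: dvd_add_left_iff)
      with units(1) show ?thesis by (rule cancel)
    qed
    moreover have "m dvd u (s + i)" if "0 < i" "i < D" for i
      using Suc.prems(2)[of "i - 1"] that by simp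
    ultimately have "m dvd u (s + i)" if "i < D" for i
      using that by (cases "i = 0") auto
    with Suc.IH Suc.prems(1) show ?case by blast
  qed simp
  show ?thesis
  proof (induction n rule: less_induct)
    case (less n)
    show ?case
    proof (cases "n < D")
      case False
      have "(\<Sum>i\<le>D. c i * u (n - D + i)) = c D * u n + (\<Sum>i<D. c i * u (n - D + i))"
        using False by (simp flip: lessThan_Suc_atMost)
      moreover have "m dvd (\<Sum>i<D. c i * u (n - D + i))"
        using less False by (intro dvd_sum dvd_mult) auto
      ultimately have "m dvd c D * u n"
        using rec[of "n - D"] by (simp add: dvd_add_left_iff)
      with units(2) show ?thesis by (rule cancel)
    qed (use base in auto)
  qed
qed

text \<open>
  There are finitely many windows of residues, so two of them agree, say at \<open>s < t\<close>. The sequence of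
  differences \<open>u (n + (t - s)) - u n\<close> satisfies the same recurrence and has a zero window at \<open>s\<close>.
\<close>

lemma linear_recurrence_periodic:
  fixes c u :: "nat \<Rightarrow> int" and m :: int
  assumes rec: "\<And>n. m dvd (\<Sum>i\<le>D. c i * u (n + i))"
    and units: "c 0 dvd 1" "c D dvd 1"
    and "m > 0"
  obtains T where "T > 0" "\<And>n. m dvd u (n + T) - u n"
proof -
  define S where "S s = map (\<lambda>i. u (s + i) mod m) [0..<D]" for s
  have "range S \<subseteq> {xs. set xs \<subseteq> {0..<m} \<and> length xs = D}"
    using \<open>m > 0\<close> by (auto simp: S_def)
  hence "finite (range S)"
    by (rule finite_subset) (simp add: finite_lists_length_eq)
  hence "\<not> inj S"
    using finite_imageD by blast
  then obtain s t where "S s = S t" "s < t"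
    unfolding inj_def by (metis nat_neq_iff)
  define v where "v n = u (n + (t - s)) - u n" for n
  have "m dvd v n" for n
  proof (rule zero_window_imp_zero[where c = c and D = D and s = s])
    fix n
    have "(\<Sum>i\<le>D. c i * v (n + i)) =
        (\<Sum>i\<le>D. c i * u (n + (t - s) + i)) - (\<Sum>i\<le>D. c i * u (n + i))"
      by (simp add: v_def algebra_simps sum_subtractf)
    thus "m dvd (\<Sum>i\<le>D. c i * v (n + i))"
      using rec dvd_diff by metis
  next
    fix i assume "i < D"
    hence "S s ! i = S t ! i" "i < length [0..<D]"
      using \<open>S s = S t\<close> by simp_all
    hence "u (s + i) mod m = u (t + i) mod m"
      using \<open>i < D\<close> by (simp add: S_def)
    thus "m dvd v (s + i)"
      using \<open>s < t\<close> by (simp add: v_def mod_eq_dvd_iff[symmetric] add.commute)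
  qed (use units in auto)
  with \<open>s < t\<close> that[of "t - s"] show ?thesis
    by (simp add: v_def)
qed

section \<open>Density of a periodic set\<close>

text \<open>
  The number of hits below \<open>N\<close> grows by a constant \<open>q\<close> over each period, hence differs from
  \<open>q * N / T\<close> by a bounded amount; meeting each of the \<open>N div D\<close> disjoint windows below \<open>N\<close>
  bounds the same number from below.
\<close>

lemma periodic_density:
  fixes P :: "nat \<Rightarrow> bool"
  assumes "T > 0" and period: "\<And>n. P (n + T) \<longleftrightarrow> P n"
    and "D > 0" and hit: "\<And>n. \<exists>i<D. P (n + i)"
  shows "\<exists>L::real. (\<lambda>N. real (card {n. n \<le> N \<and> P n}) / real N) \<longlonglongrightarrow> L \<and> L \<ge> 1 / real D"
proof -
  define C where "C N = card {n. n < N \<and> P n}" for N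
  have split: "C (M + N) = C M + card {n. n < N \<and> P (M + n)}" for M N
  proof -
    have union: "{n. n < M + N \<and> P n} = {n. n < M \<and> P n} \<union> (+) M ` {n. n < N \<and> P (M + n)}"
    proof (intro equalityI subsetI)
      fix x assume x: "x \<in> {n. n < M + N \<and> P n}"
      show "x \<in> {n. n < M \<and> P n} \<union> (+) M ` {n. n < N \<and> P (M + n)}"
      proof (cases "x < M")
        case False
        with x have "x - M \<in> {n. n < N \<and> P (M + n)}" "x = M + (x - M)" by auto
        thus ?thesis by blast
      qed (use x in auto)
    qed auto
    have "C (M + N) = C M + card ((+) M ` {n. n < N \<and> P (M + n)})"
      unfolding C_def union by (intro card_Un_disjoint) auto
    also have "card ((+) M ` {n. n < N \<and> P (M + n)}) = card {n. n < N \<and> P (M + n)}"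
      by (intro card_image) auto
    finally show ?thesis .
  qed
  have C_le: "C N \<le> N" for N
  proof -
    have "C N \<le> card {..<N}" unfolding C_def by (intro card_mono) auto
    thus ?thesis by simp
  qed
  have C_period: "C (j * T + N) = j * C T + C N" for j N
  proof (induction j)
    case (Suc j)
    have "P (T + n) \<longleftrightarrow> P n" for n
      using period[of n] by (simp add: add.commute)
    hence "C (T + (j * T + N)) = C T + C (j * T + N)"
      using split[of T "j * T + N"] by (simp add: C_def)
    with Suc show ?case by (simp add: algebra_simps)
  qed simp
  have C_lower: "j \<le> C (j * D + N)" for j N
  proof (induction j)
    case (Suc j)
    have "card {n. n < D \<and> P (j * D + N + n)} \<noteq> 0"
      using hit[of "j * D + N"] by auto
    with Suc have "Suc j \<le> C (j * D + N + D)"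
      unfolding split[of "j * D + N" D] by linarith
    thus ?case by (simp add: add_ac)
  qed simp
  define L where "L = real (C T) / real T"
  have bound: "\<bar>real (C N) - L * real N\<bar> \<le> 2 * T" for N
  proof -
    define j where "j = N div T"
    define l where "l = N mod T"
    have N: "N = j * T + l" and "l < T"
      using \<open>T > 0\<close> by (auto simp: j_def l_def)
    have "real (C N) - L * real N = real (C l) - L * real l"
      using \<open>T > 0\<close> unfolding N C_period by (simp add: L_def field_simps)
    moreover have "real (C l) \<le> T"
      using C_le[of l] \<open>l < T\<close> by simp
    moreover have "0 \<le> L" "L \<le> 1"
      using C_le[of T] \<open>T > 0\<close> by (auto simp: L_def)
    hence "0 \<le> L * real l" "L * real l \<le> 1 * real T"
      using \<open>l < T\<close> by (auto simp del: mult_1 intro!: mult_mono)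
    ultimately show ?thesis by simp
  qed
  \<comment> \<open>\<open>C\<close> counts strictly below its argument, the density counts up to and including \<open>N\<close>.\<close>
  define f where "f N = real (C (Suc N)) / real N" for N
  have "f \<longlonglongrightarrow> L"
  proof (rule LIM_zero_cancel, rule tendsto_0_le[where K = 1])
    show "\<forall>\<^sub>F N in sequentially. norm (f N - L) \<le> norm ((2 * real T + 1) / real N) * 1"
    proof (rule eventually_sequentiallyI)
      fix N :: nat assume "N \<ge> 1"
      have "C N \<le> C (Suc N)" "C (Suc N) \<le> C N + 1"
        using split[of N 1] card_mono[of "{..<1::nat}" "{n. n < 1 \<and> P (N + n)}"] by auto
      hence "\<bar>real (C (Suc N)) - L * real N\<bar> \<le> 2 * real T + 1"
        using bound[of N] by linarith
      moreover have "f N - L = (real (C (Suc N)) - L * real N) / real N"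
        using \<open>N \<ge> 1\<close> by (simp add: f_def field_simps)
      ultimately show "norm (f N - L) \<le> norm ((2 * real T + 1) / real N) * 1"
        using \<open>N \<ge> 1\<close> by (simp add: abs_divide divide_right_mono)
    qed
    show "(\<lambda>N. (2 * real T + 1) / real N) \<longlonglongrightarrow> 0"
      by (rule lim_const_over_n)
  qed
  moreover have "1 / real D \<le> L"
  proof (rule LIMSEQ_le[OF _ \<open>f \<longlonglongrightarrow> L\<close>])
    show "(\<lambda>N. 1 / real D - 1 / real N) \<longlonglongrightarrow> 1 / real D"
      using tendsto_diff[OF tendsto_const lim_const_over_n[of "1::real"]] by simp
    have "1 / real D - 1 / real N \<le> f N" if "N \<ge> 1" for N
    proof -
      have "N div D \<le> C (Suc N)"
        using C_lower[of "N div D" "Suc (N mod D)"] by simp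
      moreover have "real N / real D \<le> real (N div D) + 1"
      proof -
        have "N \<le> (N div D + 1) * D"
          using dividend_less_div_times[OF \<open>D > 0\<close>, of N] by simp
        hence "real N \<le> real ((N div D + 1) * D)" by (rule of_nat_mono)
        with \<open>D > 0\<close> show ?thesis by (simp add: pos_divide_le_eq distrib_right)
      qed
      ultimately have "real N / real D - 1 \<le> real (C (Suc N))"
        by linarith
      hence "(real N / real D - 1) / real N \<le> f N"
        unfolding f_def by (intro divide_right_mono) auto
      thus ?thesis using that by (simp add: diff_divide_distrib)
    qed
    thus "\<exists>M. \<forall>N\<ge>M. 1 / real D - 1 / real N \<le> f N" by blast
  qed
  ultimately show ?thesis
    by (auto simp: f_def[abs_def] C_def less_Suc_eq_le)
qed

section \<open>The generating function of weighted solutions\<close>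

text \<open>
  The index type is arbitrary so that pairs \<open>(j, i)\<close> can index all components of a tuple of vectors
  at once, while induction adds one index at a time.
\<close>

definition weighted_solutions :: "'i set \<Rightarrow> ('i \<Rightarrow> nat) \<Rightarrow> nat \<Rightarrow> ('i \<Rightarrow> nat) set" where
  "weighted_solutions I w n = {x \<in> I \<rightarrow>\<^sub>E UNIV. (\<Sum>i\<in>I. w i * x i) = n}"

lemma finite_weighted_solutions:
  assumes "finite I" "\<And>i. i \<in> I \<Longrightarrow> w i > 0"
  shows "finite (weighted_solutions I w n)"
proof (rule finite_subset)
  show "weighted_solutions I w n \<subseteq> I \<rightarrow>\<^sub>E {..n}"
  proof
    fix x assume x: "x \<in> weighted_solutions I w n"
    have "x i \<le> n" if "i \<in> I" for i
    proof -
      have "x i \<le> w i * x i" using assms(2)[OF that] by simp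
      also have "\<dots> \<le> (\<Sum>i\<in>I. w i * x i)"
        using assms(1) that by (intro member_le_sum) auto
      finally show ?thesis using x by (simp add: weighted_solutions_def)
    qed
    with x show "x \<in> I \<rightarrow>\<^sub>E {..n}" by (auto simp: weighted_solutions_def PiE_iff)
  qed
qed (use assms in \<open>auto intro!: finite_PiE\<close>)

text \<open>
  Either the new variable is zero, leaving a solution over \<open>I\<close>, or it can be lowered by one.
  On generating functions, this says that adding a variable of weight \<open>w b\<close> divides by
  \<open>1 - X ^ w b\<close>.
\<close>

lemma card_weighted_solutions_insert:
  assumes "finite I" "b \<notin> I" and pos: "\<And>i. i \<in> insert b I \<Longrightarrow> w i > 0"
  shows "card (weighted_solutions (insert b I) w n) = card (weighted_solutions I w n) +
    (if w b \<le> n then card (weighted_solutions (insert b I) w (n - w b)) else 0)"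
proof -
  let ?S = "weighted_solutions (insert b I) w"
  have sum_upd: "(\<Sum>i\<in>I. w i * (if i = b then y else x i)) = (\<Sum>i\<in>I. w i * x i)" for x y
    using \<open>b \<notin> I\<close> by (intro sum.cong) auto
  have mem: "x \<in> ?S l \<longleftrightarrow> x \<in> insert b I \<rightarrow>\<^sub>E UNIV \<and> w b * x b + (\<Sum>i\<in>I. w i * x i) = l" for x l
    using assms(1,2) by (simp add: weighted_solutions_def)
  have mem_I: "x \<in> weighted_solutions I w l \<longleftrightarrow> x \<in> I \<rightarrow>\<^sub>E UNIV \<and> (\<Sum>i\<in>I. w i * x i) = l" for x l
    by (simp add: weighted_solutions_def)
  have zero: "card {x \<in> ?S n. x b = 0} = card (weighted_solutions I w n)"
  proof (rule bij_betw_same_card)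
    show "bij_betw (\<lambda>x. x(b := undefined)) {x \<in> ?S n. x b = 0} (weighted_solutions I w n)"
      by (rule bij_betw_byWitness[where f' = "\<lambda>x. x(b := 0)"])
        (use \<open>b \<notin> I\<close> in \<open>auto simp: mem mem_I sum_upd PiE_iff extensional_def fun_eq_iff\<close>)
  qed
  have pos_part: "card {x \<in> ?S n. x b > 0} = (if w b \<le> n then card (?S (n - w b)) else 0)"
  proof (cases "w b \<le> n")
    case True
    have "bij_betw (\<lambda>x. x(b := x b - 1)) {x \<in> ?S n. x b > 0} (?S (n - w b))"
    proof (rule bij_betw_byWitness[where f' = "\<lambda>x. x(b := x b + 1)"])
      show "(\<lambda>x. x(b := x b - 1)) ` {x \<in> ?S n. x b > 0} \<subseteq> ?S (n - w b)"
        by (auto simp: mem sum_upd PiE_iff extensional_def diff_mult_distrib2)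
      show "(\<lambda>x. x(b := x b + 1)) ` ?S (n - w b) \<subseteq> {x \<in> ?S n. x b > 0}"
        using True by (auto simp: mem sum_upd PiE_iff extensional_def)
    qed auto
    with True show ?thesis by (auto dest: bij_betw_same_card)
  next
    case False
    have "{x \<in> ?S n. x b > 0} = {}"
    proof (intro equals0I)
      fix x assume x: "x \<in> {x \<in> ?S n. x b > 0}"
      hence "w b * 1 \<le> w b * x b" by (intro mult_le_mono2) auto
      with x False show False by (simp add: mem)
    qed
    with False show ?thesis by (metis card.empty)
  qed
  have "?S n = {x \<in> ?S n. x b = 0} \<union> {x \<in> ?S n. x b > 0}" by auto
  hence "card (?S n) = card ({x \<in> ?S n. x b = 0} \<union> {x \<in> ?S n. x b > 0})" by (rule arg_cong)
  also have "\<dots> = card {x \<in> ?S n. x b = 0} + card {x \<in> ?S n. x b > 0}"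
    using finite_weighted_solutions[of "insert b I" w n, OF _ pos] \<open>finite I\<close>
    by (intro card_Un_disjoint) auto
  finally show ?thesis by (simp only: zero pos_part)
qed

lemma weighted_solutions_fps:
  assumes "finite I" "\<And>i. i \<in> I \<Longrightarrow> w i > 0"
  shows "fps_of_poly (\<Prod>i\<in>I. 1 - monom 1 (w i)) *
    Abs_fps (\<lambda>n. int (card (weighted_solutions I w n))) = 1"
  using assms
proof (induction I)
  case empty
  show ?case
    by (auto simp: weighted_solutions_def fps_eq_iff)
next
  case (insert b I)
  let ?F = "\<lambda>I. Abs_fps (\<lambda>n. int (card (weighted_solutions I w n)))"
  have "(1 - fps_X ^ w b) * ?F (insert b I) = ?F I"
    using card_weighted_solutions_insert[of I b w] insert
    by (auto simp: fps_eq_iff algebra_simps fps_X_power_mult_nth)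
  moreover have "fps_of_poly (1 - monom 1 (w b) :: int poly) = 1 - fps_X ^ w b"
    by (simp add: fps_of_poly_diff fps_of_poly_monom')
  ultimately have "fps_of_poly (\<Prod>i\<in>insert b I. 1 - monom 1 (w i)) * ?F (insert b I) =
      fps_of_poly (\<Prod>i\<in>I. 1 - monom 1 (w i)) * ?F I"
    by (simp only: prod.insert[OF insert.hyps] fps_of_poly_mult mult.assoc
        mult.left_commute[of "1 - fps_X ^ w b"])
  with insert show ?case by simp
qed

lemma multipartition_count_eq:
  "multipartition_count k r a n = card (weighted_solutions ({1..k} \<times> {1..r}) (a \<circ> snd) n)"
  unfolding multipartition_count_def
proof (rule bij_betw_same_card)
  show "bij_betw (\<lambda>x. \<lambda>p\<in>{1..k} \<times> {1..r}. x (fst p) (snd p))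
    {x \<in> {1..k} \<rightarrow>\<^sub>E ({1..r} \<rightarrow>\<^sub>E (UNIV :: nat set)). (\<Sum>j = 1..k. \<Sum>i = 1..r. a i * x j i) = n}
    (weighted_solutions ({1..k} \<times> {1..r}) (a \<circ> snd) n)"
    by (rule bij_betw_byWitness[where f' = "\<lambda>y. \<lambda>j\<in>{1..k}. \<lambda>i\<in>{1..r}. y (j, i)"])
      (auto simp: weighted_solutions_def sum.cartesian_product PiE_iff extensional_def fun_eq_iff
         case_prod_unfold intro!: sum.cong)
qed

section \<open>Nonvanishing of multipartition numbers modulo m\<close>

lemma
  fixes w :: "'i \<Rightarrow> nat"
  assumes "finite I" "\<And>i. i \<in> I \<Longrightarrow> w i > 0"
  defines "Q \<equiv> (\<Prod>i\<in>I. 1 - monom (1::int) (w i))"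
  shows coeff_0_prod_one_minus_monom: "coeff Q 0 = 1"
    and degree_prod_one_minus_monom: "degree Q = (\<Sum>i\<in>I. w i)"
    and lead_coeff_prod_one_minus_monom: "lead_coeff Q dvd 1"
proof -
  have deg: "degree (1 - monom (1::int) l) = l" if "l > 0" for l
    using that degree_add_eq_left[of 1 "- monom (1::int) l"] by (simp add: degree_monom_eq)
  have lead: "lead_coeff (1 - monom (1::int) l) = -1" if "l > 0" for l
    using that by (subst deg) auto
  have nz: "1 - monom (1::int) (w i) \<noteq> 0" if "i \<in> I" for i
    using lead[OF assms(2)[OF that]] by fastforce
  show "coeff Q 0 = 1"
    using assms(2) unfolding Q_def
    by (auto simp: poly_prod poly_monom simp flip: poly_0_coeff_0 intro!: prod.neutral)
  show "degree Q = (\<Sum>i\<in>I. w i)"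
    unfolding Q_def using assms(2) nz by (subst degree_prod_eq_sum_degree) (auto simp: deg)
  have "lead_coeff Q = (\<Prod>i\<in>I. -1)"
    unfolding Q_def lead_coeff_prod using assms(2) lead by (intro prod.cong) auto
  thus "lead_coeff Q dvd 1" by simp
qed

theorem corollary3p4:
  fixes r k m :: nat and a :: "nat \<Rightarrow> nat"
  assumes "r \<ge> 1" and "k \<ge> 2"
    and "\<And>i. i \<in> {1..r} \<Longrightarrow> a i > 0"
    and "m > 1"
  shows "\<exists>L :: real.
    (\<lambda>N :: nat. real (card {n. n \<le> N \<and> \<not> [multipartition_count k r a n = 0] (mod m)}) / real N)
       \<longlonglongrightarrow> L
    \<and> L \<ge> 1 / (real k * (\<Sum>i = 1..r. real (a i)))"
proof -
  define I where "I = {1..k} \<times> {1..r}"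
  define w where "w = a \<circ> (snd :: nat \<times> nat \<Rightarrow> nat)"
  define u where "u n = int (multipartition_count k r a n)" for n
  define Q where "Q = (\<Prod>i\<in>I. 1 - monom (1::int) (w i))"
  define D where "D = degree Q"
  \<comment> \<open>Coefficients in reverse order, because \<open>c i\<close> multiplies the later value \<open>u (n + i)\<close>.\<close>
  define c where "c i = coeff Q (D - i)" for i
  have I: "finite I" "\<And>i. i \<in> I \<Longrightarrow> w i > 0"
    using assms(3) by (auto simp: I_def w_def)
  have D: "D = k * (\<Sum>i = 1..r. a i)"
  proof -
    have "D = (\<Sum>p\<in>I. w p)"
      unfolding D_def Q_def using I by (rule degree_prod_one_minus_monom)
    also have "\<dots> = (\<Sum>j = 1..k. \<Sum>i = 1..r. a i)"
      unfolding I_def w_def sum.cartesian_product by (simp add: case_prod_unfold)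
    finally show ?thesis by simp
  qed
  have "a 1 \<le> (\<Sum>i = 1..r. a i)"
    using assms(1) by (intro member_le_sum) auto
  hence "D > 0"
    using D assms(1,2) assms(3)[of 1] by simp
  have units: "c 0 dvd 1" "c D dvd 1"
    using lead_coeff_prod_one_minus_monom[OF I] coeff_0_prod_one_minus_monom[OF I]
    by (simp_all add: c_def D_def Q_def)
  have fps: "fps_of_poly Q * Abs_fps u = 1"
    using weighted_solutions_fps[OF I]
    by (simp only: Q_def u_def[abs_def] multipartition_count_eq I_def w_def)
  have rec: "(\<Sum>i\<le>D. c i * u (n + i)) = 0" for n
  proof -
    have "(\<Sum>i\<le>D. c i * u (n + i)) = (\<Sum>i\<le>D. coeff Q i * u (n + D - i))"
      by (rule sum.reindex_bij_witness[of _ "\<lambda>i. D - i" "\<lambda>i. D - i"]) (auto simp: c_def)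
    also have "\<dots> = (\<Sum>i=0..n + D. coeff Q i * u (n + D - i))"
      by (rule sum.mono_neutral_left) (auto simp: D_def coeff_eq_0)
    also have "\<dots> = fps_nth (fps_of_poly Q * Abs_fps u) (n + D)"
      by (simp add: fps_mult_nth)
    \<comment> \<open>As \<open>D > 0\<close>, this coefficient of the series \<open>1\<close> is never the constant one.\<close>
    finally show ?thesis using \<open>D > 0\<close> by (simp add: fps)
  qed
  have rec': "int m dvd (\<Sum>i\<le>D. c i * u (n + i))" for n
    by (simp add: rec)
  have "u 0 = 1"
  proof -
    have "fps_nth (fps_of_poly Q * Abs_fps u) 0 = 1" by (simp add: fps)
    thus ?thesis
      using coeff_0_prod_one_minus_monom[OF I] by (simp add: Q_def)
  qed
  have hit: "\<exists>i<D. \<not> int m dvd u (n + i)" for n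
  proof (rule ccontr)
    assume "\<not> ?thesis"
    hence "int m dvd u 0"
      using zero_window_imp_zero[OF rec' units, of n 0] by blast
    with \<open>u 0 = 1\<close> \<open>m > 1\<close> show False by simp
  qed
  obtain T where T: "T > 0" "\<And>n. int m dvd u (n + T) - u n"
    using linear_recurrence_periodic[OF rec' units] \<open>m > 1\<close> by auto
  have period: "\<not> int m dvd u (n + T) \<longleftrightarrow> \<not> int m dvd u n" for n
    using dvd_add_right_iff[OF T(2)[of n], of "u n"] by simp
  have "[multipartition_count k r a n = 0] (mod m) \<longleftrightarrow> int m dvd u n" for n
    by (simp add: u_def cong_0_iff)
  thus ?thesis
    using periodic_density[where P = "\<lambda>n. \<not> int m dvd u n", OF T(1) period \<open>D > 0\<close> hit]
    by (simp add: D)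
qed

end
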